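(* Let $G$ be a finite group and let $\mathcal F$ be a family of extensions of $G$. Let $\Sigma$ be the set of all supplement functions for $\mathcal F$ that are preserved by a $G$-isomorphism. Then for every $S\in\Sigma$ there exists $\widetilde S\in\Sigma$ such that for every $E\in\mathcal F$ the group $G\cap\widetilde S(E)$ is nilpotent and $\widetilde S(E)\subseteq S(E)$.
   Context: An extension of $G$ is a group $E$ containing $G$ as a normal subgroup (neither $E$ nor $E/G$ is assumed finite). A supplement to $G$ in $E$ is a subgroup $S$ of $E$ with $E=SG$. A supplement function for a family $\mathcal F$ of extensions of $G$ is a function assigning to each $E\in\mathcal F$ a supplement $S(E)$ to $G$ in $E$. A $G$-isomorphism $E_1\to E_2$ between extensions of $G$ is a group isomorphism $j$ with $j(G)=G$. A supplement function $S$ is preserved by a $G$-isomorphism if for every pair $E_1,E_2\in\mathcal F$ of $G$-isomorphic extensions there exists a $G$-isomorphism $j:E_1\to E_2$ with $j(S(E_1))=S(E_2)$. *)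

theory Defs
  imports "HOL-Algebra.Generated_Groups"
begin

text \<open>Containment of groups is literal: the carrier of \<open>G\<close> is a subset of the carrier of \<open>E\<close> and
  the two multiplications agree on it. That the units and inverses agree then follows.\<close>

definition group_extension :: "('a, 'c) monoid_scheme \<Rightarrow> ('a, 'b) monoid_scheme \<Rightarrow> bool" where
  "group_extension G E \<longleftrightarrow>
     carrier G \<lhd> E \<and> (\<forall>x\<in>carrier G. \<forall>y\<in>carrier G. x \<otimes>\<^bsub>E\<^esub> y = x \<otimes>\<^bsub>G\<^esub> y)"

definition supplement ::
  "('a, 'c) monoid_scheme \<Rightarrow> ('a, 'b) monoid_scheme \<Rightarrow> 'a set \<Rightarrow> bool" where
  "supplement G E H \<longleftrightarrow> subgroup H E \<and> carrier E = H <#>\<^bsub>E\<^esub> carrier G"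

text \<open>Functions with domain \<open>F\<close> are represented by extensional functions.\<close>

definition supplement_functions ::
  "('a, 'c) monoid_scheme \<Rightarrow> ('a, 'b) monoid_scheme set \<Rightarrow> (('a, 'b) monoid_scheme \<Rightarrow> 'a set) set"
  where
  "supplement_functions G F = (\<Pi>\<^sub>E E\<in>F. {H. supplement G E H})"

definition relative_iso ::
  "('a, 'c) monoid_scheme \<Rightarrow> ('a, 'b) monoid_scheme \<Rightarrow> ('a, 'b) monoid_scheme \<Rightarrow> ('a \<Rightarrow> 'a) set"
  where
  "relative_iso G E\<^sub>1 E\<^sub>2 = {j \<in> iso E\<^sub>1 E\<^sub>2. j ` carrier G = carrier G}"

definition preserved_by_iso ::
  "('a, 'c) monoid_scheme \<Rightarrow> ('a, 'b) monoid_scheme set \<Rightarrow> (('a, 'b) monoid_scheme \<Rightarrow> 'a set) \<Rightarrow> bool"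
  where
  "preserved_by_iso G F S \<longleftrightarrow>
     (\<forall>E\<^sub>1\<in>F. \<forall>E\<^sub>2\<in>F. relative_iso G E\<^sub>1 E\<^sub>2 \<noteq> {} \<longrightarrow>
        (\<exists>j\<in>relative_iso G E\<^sub>1 E\<^sub>2. j ` S E\<^sub>1 = S E\<^sub>2))"

definition preserved_supplement_functions ::
  "('a, 'c) monoid_scheme \<Rightarrow> ('a, 'b) monoid_scheme set \<Rightarrow> (('a, 'b) monoid_scheme \<Rightarrow> 'a set) set"
  where
  "preserved_supplement_functions G F = {S \<in> supplement_functions G F. preserved_by_iso G F S}"

text \<open>Nilpotency is termination of the lower central series at the trivial subgroup.\<close>

definition commutator_subgroup :: "('a, 'b) monoid_scheme \<Rightarrow> 'a set \<Rightarrow> 'a set \<Rightarrow> 'a set" where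
  "commutator_subgroup G H K =
     generate G (\<Union>h\<in>H. \<Union>k\<in>K. {h \<otimes>\<^bsub>G\<^esub> k \<otimes>\<^bsub>G\<^esub> inv\<^bsub>G\<^esub> h \<otimes>\<^bsub>G\<^esub> inv\<^bsub>G\<^esub> k})"

primrec lower_central :: "('a, 'b) monoid_scheme \<Rightarrow> nat \<Rightarrow> 'a set" where
  "lower_central G 0 = carrier G"
| "lower_central G (Suc n) = commutator_subgroup G (lower_central G n) (carrier G)"

definition nilpotent_group :: "('a, 'b) monoid_scheme \<Rightarrow> bool" where
  "nilpotent_group G \<longleftrightarrow> group G \<and> (\<exists>n. lower_central G n = {\<one>\<^bsub>G\<^esub>})"

end

theory Submission
  imports Defs "HOL-Algebra.Group_Action" "HOL-Algebra.Sylow"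
begin

text \<open>
  Let \<open>T\<close> be a supplement of \<open>G\<close> in \<open>E\<close> for which \<open>\<bar>G \<inter> T\<bar>\<close> is minimal among the supplements
  contained in \<open>S E\<close>, and let \<open>P\<close> be a Sylow subgroup of \<open>G \<inter> T\<close>. By the Frattini argument
  the normalizer of \<open>P\<close> in \<open>T\<close> is again a supplement, so by minimality it contains \<open>G \<inter> T\<close>.
  Thus all Sylow subgroups of \<open>G \<inter> T\<close> are normal and \<open>G \<inter> T\<close> is nilpotent. To preserve the
  supplement function, \<open>T\<close> is chosen only for one representative \<open>E\<^sub>0\<close> of each \<open>G\<close>-isomorphism
  class in \<open>F\<close> and carried to the other members \<open>E\<close> by an isomorphism that maps \<open>S E\<^sub>0\<close> to \<open>S E\<close>.
\<close>

section \<open>Finite p-groups and the conjugacy of Sylow subgroups\<close>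

lemma not_power_Suc_multiplicity_dvd:
  fixes p n :: nat
  assumes "prime p" "n \<noteq> 0"
  shows "\<not> p ^ Suc (multiplicity p n) dvd n"
  using assms by (meson Suc_n_not_le_n multiplicity_geI not_prime_unit)

text \<open>Each \<open>f g\<close> is automatically bijective, with inverse
  \<open>f (inv g)\<close>, so the three axioms suffice. The restriction to \<open>E\<close> is
  there because the elements of \<open>BijGroup E\<close> are extensional.\<close>

lemma (in group) group_actionI:
  assumes closed: "\<And>g x. g \<in> carrier G \<Longrightarrow> x \<in> E \<Longrightarrow> f g x \<in> E"
    and one: "\<And>x. x \<in> E \<Longrightarrow> f \<one> x = x"
    and mult: "\<And>g h x. g \<in> carrier G \<Longrightarrow> h \<in> carrier G \<Longrightarrow> x \<in> E \<Longrightarrow> f (g \<otimes> h) x = f g (f h x)"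
  shows "group_action G E (\<lambda>g. \<lambda>x\<in>E. f g x)"
proof -
  have Bij: "(\<lambda>x\<in>E. f g x) \<in> Bij E" if g: "g \<in> carrier G" for g
  proof -
    have "bij_betw (f g) E E"
    proof (rule bij_betw_byWitness[where f' = "f (inv g)"])
      show "\<forall>x\<in>E. f (inv g) (f g x) = x" "\<forall>x\<in>E. f g (f (inv g) x) = x"
        using g one by (simp_all flip: mult)
    qed (use g closed in auto)
    then show ?thesis by (auto simp: Bij_def cong: bij_betw_cong)
  qed
  have "(\<lambda>g. \<lambda>x\<in>E. f g x) \<in> hom G (BijGroup E)"
    using Bij by (auto simp: hom_def BijGroup_def compose_def mult closed intro!: restrict_ext)
  then show ?thesis
    by (simp add: group_action_def group_hom_def group_hom_axioms_def group_BijGroup is_group)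
qed

text \<open>The moved points form the union of the orbits with more than one element, and by the
  orbit-stabilizer theorem the length of each such orbit is a positive power of \<open>p\<close>.
  Counting moved rather than fixed points turns the usual congruence into a divisibility.\<close>

lemma (in group_action) p_group_dvd_card_moved:
  assumes p: "prime p" and ord: "order G = p ^ n" and fin: "finite E"
  shows "p dvd card {x \<in> E. \<exists>g\<in>carrier G. \<phi> g x \<noteq> x}"
proof -
  define M where "M = {x \<in> E. \<exists>g\<in>carrier G. \<phi> g x \<noteq> x}"
  \<comment> \<open>Summing the indicator of \<open>M\<close> orbit by orbit reduces the count to
    single orbits: an orbit inside \<open>M\<close> contributes its length, and any other orbit is a
    single fixed point and contributes 0.\<close>
  have dvd: "p dvd (\<Sum>x\<in>orb. of_bool (x \<in> M))" if orb: "orb \<in> orbits G E \<phi>" for orb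
  proof -
    obtain x where x: "x \<in> E" and orb_eq: "orb = orbit G \<phi> x"
      using orb by (auto simp: orbits_def)
    have sub: "orb \<subseteq> E"
      using orb orbits_coverture by blast
    then have finorb: "finite orb" using fin finite_subset by blast
    show ?thesis
    proof (cases "orb \<subseteq> M")
      case True
      have "card orb dvd p ^ n"
        using orbit_stabilizer_theorem[OF x] ord orb_eq by (metis dvd_triv_left)
      then obtain k where k: "card orb = p ^ k"
        using p divides_primepow_nat by auto
      have "k \<noteq> 0"
      proof
        assume "k = 0"
        then obtain y where "orb = {y}" using k card_1_singletonE by force
        then have "\<phi> g x = x" if "g \<in> carrier G" for g
          using that orb_eq orbit_refl[OF x] by (auto simp: orbit_def)
        then show False using True orb_eq orbit_refl[OF x] by (auto simp: M_def)
      qed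
      moreover have "(\<Sum>x\<in>orb. of_bool (x \<in> M)) = card orb"
        using True by (simp add: subset_iff)
      ultimately show ?thesis using k by simp
    next
      case False
      then obtain y where y: "y \<in> orb" "y \<notin> M" by blast
      then have "orbit G \<phi> y \<subseteq> {y}"
        using sub by (auto simp: M_def orbit_def)
      moreover have "z \<in> orbit G \<phi> y" if "z \<in> orb" for z
        using that y x sub orb_eq by (meson orbit_sym orbit_trans subsetD)
      ultimately have "orb = {y}" using y by blast
      then show ?thesis using y by simp
    qed
  qed
  have "card M = (\<Sum>x\<in>E. of_bool (x \<in> M))"
    using fin by (simp add: M_def Int_def)
  also have "\<dots> = (\<Sum>orb\<in>orbits G E \<phi>. \<Sum>x\<in>orb. of_bool (x \<in> M))"
    using disjoint_sum[OF fin, of "\<lambda>x. of_bool (x \<in> M) :: nat"] by simp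
  finally show ?thesis
    using dvd by (simp add: M_def dvd_sum)
qed

text \<open>The fixed points of conjugation are the central elements. If only the identity were
  central, then \<open>p\<close> would divide both the order and the order minus 1.\<close>

lemma (in group) p_group_nontrivial_center:
  assumes p: "prime p" and ord: "order G = p ^ n" and ne: "carrier G \<noteq> {\<one>}"
  shows "\<exists>z\<in>carrier G - {\<one>}. \<forall>g\<in>carrier G. g \<otimes> z = z \<otimes> g"
proof (rule ccontr)
  assume no_center: "\<not> ?thesis"
  have "order G \<noteq> 1" using ne order_one_triv_iff by blast
  then have "p dvd order G" using ord p by (cases n) auto
  have fin: "finite (carrier G)"
    using ord p order_gt_0_iff_finite by (metis prime_gt_0_nat zero_less_power)
  interpret conj: group_action G "carrier G" "\<lambda>g. \<lambda>h\<in>carrier G. g \<otimes> h \<otimes> inv g"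
    by (rule action_by_conjugation)
  have "g \<otimes> z = z \<otimes> g" if "g \<in> carrier G" "z \<in> carrier G" "g \<otimes> z \<otimes> inv g = z" for g z
    using that by (metis inv_solve_right' m_closed)
  then have "\<exists>g\<in>carrier G. g \<otimes> z \<otimes> inv g \<noteq> z" if "z \<in> carrier G - {\<one>}" for z
    using no_center that by blast
  then have "{x \<in> carrier G. \<exists>g\<in>carrier G. (\<lambda>h\<in>carrier G. g \<otimes> h \<otimes> inv g) x \<noteq> x} = carrier G - {\<one>}"
    by auto
  then have "p dvd order G - 1"
    using conj.p_group_dvd_card_moved[OF p ord fin] fin by (simp add: order_def)
  moreover have "order G > 0" using fin order_gt_0_iff_finite by blast
  ultimately have "p dvd 1"
    using \<open>p dvd order G\<close> by (metis One_nat_def Suc_leI dvd_diffD1)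
  then show False using p by simp
qed

text \<open>\<open>Q\<close> acts on the right cosets of \<open>P\<close>, whose number is prime to
  \<open>p\<close>, so some coset \<open>P #> g\<close> is fixed. Being fixed means that
  \<open>g\<close> conjugates \<open>Q\<close> into \<open>P\<close>.\<close>

lemma (in group) p_subgroup_conj_subset:
  assumes p: "prime p" and fin: "finite (carrier G)" and P: "subgroup P G"
    and ndvd: "\<not> p dvd card (rcosets P)" and Q: "subgroup Q G" and cardQ: "card Q = p ^ k"
  shows "\<exists>g\<in>carrier G. \<forall>q\<in>Q. g \<otimes> q \<otimes> inv g \<in> P"
proof -
  interpret Q: group "G\<lparr>carrier := Q\<rparr>" using Q by (rule subgroup_imp_group)
  have Qc: "q \<in> carrier G" if "q \<in> Q" for q
    using that subgroup.mem_carrier[OF Q] by simp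
  have Pc: "P \<subseteq> carrier G" using P subgroup.subset by blast
  \<comment> \<open>Multiplication on the right reverses products; the inverse makes it a left
    action.\<close>
  interpret act: group_action "G\<lparr>carrier := Q\<rparr>" "rcosets P" "\<lambda>q. \<lambda>R\<in>rcosets P. R #> inv q"
  proof (rule Q.group_actionI)
    fix q R assume "q \<in> carrier (G\<lparr>carrier := Q\<rparr>)" "R \<in> rcosets P"
    then show "R #> inv q \<in> rcosets P"
      using Pc by (auto simp: RCOSETS_def Qc coset_mult_assoc)
  next
    fix R assume "R \<in> rcosets P"
    then show "R #> inv \<one>\<^bsub>G\<lparr>carrier := Q\<rparr>\<^esub> = R"
      using Pc by (auto simp: RCOSETS_def coset_mult_assoc)
  next
    fix q q' R
    assume "q \<in> carrier (G\<lparr>carrier := Q\<rparr>)" "q' \<in> carrier (G\<lparr>carrier := Q\<rparr>)" "R \<in> rcosets P"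
    then show "R #> inv (q \<otimes>\<^bsub>G\<lparr>carrier := Q\<rparr>\<^esub> q') = R #> inv q' #> inv q"
      using Pc by (auto simp: RCOSETS_def Qc coset_mult_assoc inv_mult_group m_assoc)
  qed
  have finR: "finite (rcosets P)"
    using fin rcosets_subset_PowG[OF P] finite_subset by blast
  have "{R \<in> rcosets P. \<exists>q\<in>Q. R #> inv q \<noteq> R} \<noteq> rcosets P"
    using act.p_group_dvd_card_moved[OF p _ finR, of k] cardQ ndvd
    by (auto simp: order_def cong: conj_cong)
  then obtain R where "R \<in> rcosets P" and fixed: "\<And>q. q \<in> Q \<Longrightarrow> R #> inv q = R"
    by blast
  then obtain g where g: "g \<in> carrier G" and R: "R = P #> g"
    by (auto simp: RCOSETS_def)
  have "g \<otimes> q \<otimes> inv g \<in> P" if q: "q \<in> Q" for q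
  proof -
    \<comment> \<open>The action uses inverses, so the fixed point property is taken at
      \<open>inv q\<close>.\<close>
    have "P #> (g \<otimes> q) = P #> g"
      using fixed[of "inv q"] q Q R g Pc Qc by (simp add: coset_mult_assoc subgroup.m_inv_closed)
    then show ?thesis
      using P g Qc[OF q] by (metis is_group m_closed repr_independenceD subgroup.rcos_module_imp)
  qed
  then show ?thesis using g by blast
qed

lemma (in group) normalizer_iff:
  assumes "P \<subseteq> carrier G"
  shows "g \<in> normalizer G P \<longleftrightarrow> g \<in> carrier G \<and> g <# P #> inv g = P"
  using assms by (auto simp: normalizer_def stabilizer_def)

lemma (in group) conj_set_eq_image: "g <# P #> h = (\<lambda>x. g \<otimes> x \<otimes> h) ` P"
  by (auto simp: l_coset_def r_coset_def)

text \<open>For \<open>g\<close> in the group, the conjugate of \<open>P\<close> by \<open>g\<close>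
  stays in the normal subgroup \<open>N\<close> and is again a Sylow subgroup of \<open>N\<close>.
  Some \<open>n\<close> in \<open>N\<close> conjugates it back into \<open>P\<close>, hence
  \<open>n \<otimes> g\<close> normalizes \<open>P\<close>. Only \<open>N\<close> has to be finite,
  since conjugacy is used inside \<open>N\<close> alone.\<close>

lemma (in group) frattini_argument:
  assumes N: "N \<lhd> G" and fin: "finite N" and p: "prime p"
    and P: "subgroup P (G\<lparr>carrier := N\<rparr>)" and cardP: "card P = p ^ multiplicity p (card N)"
  shows "carrier G = normalizer G P <#> N"
proof -
  have subN: "subgroup N G" using N by (rule normal_imp_subgroup)
  interpret N: group "G\<lparr>carrier := N\<rparr>" using subN by (rule subgroup_imp_group)
  have PN: "P \<subseteq> N" using subgroup.subset[OF P] by simp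
  have Nc: "N \<subseteq> carrier G" using subgroup.subset[OF subN] .
  have Pc: "P \<subseteq> carrier G" using PN Nc by blast
  have subP: "subgroup P G" using incl_subgroup[OF subN P] .
  have "card (rcosets\<^bsub>G\<lparr>carrier := N\<rparr>\<^esub> P) * p ^ multiplicity p (card N) = card N"
    using N.lagrange[OF P] cardP by (simp add: order_def)
  then have "card N = card (rcosets\<^bsub>G\<lparr>carrier := N\<rparr>\<^esub> P) * p ^ multiplicity p (card N)" ..
  moreover have "card N \<noteq> 0" using fin subgroup.one_closed[OF subN] by auto
  moreover have "\<not> p ^ Suc (multiplicity p (card N)) dvd card N"
    using p \<open>card N \<noteq> 0\<close> by (rule not_power_Suc_multiplicity_dvd)
  ultimately have ndvd: "\<not> p dvd card (rcosets\<^bsub>G\<lparr>carrier := N\<rparr>\<^esub> P)"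
    by (metis dvd_refl mult_dvd_mono power_Suc)
  have finP: "finite P" using fin PN finite_subset by blast
  have factor: "g \<in> N <#> normalizer G P" if g: "g \<in> carrier G" for g
  proof -
    let ?Q = "g <# P #> inv g"
    have QN: "?Q \<subseteq> N"
      using normal_invE(2)[OF N g] PN by (auto simp: conj_set_eq_image)
    have Q: "subgroup ?Q (G\<lparr>carrier := N\<rparr>)"
      using subgroup_incl[OF subgroup_conjugation_is_surj2[OF g subP] subN QN] .
    have "card ?Q = card P"
      unfolding conj_set_eq_image
      using Pc g by (intro card_image inj_onI) (auto simp: subset_iff)
    then have "card ?Q = p ^ multiplicity p (card N)" using cardP by simp
    then obtain n where n: "n \<in> N" and "\<forall>q\<in>?Q. n \<otimes> q \<otimes> inv n \<in> P"
      using N.p_subgroup_conj_subset[OF p _ P ndvd Q] fin subN by auto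
    then have conj: "n \<otimes> (g \<otimes> x \<otimes> inv g) \<otimes> inv n \<in> P" if "x \<in> P" for x
      using that by (simp add: conj_set_eq_image)
    have nc: "n \<in> carrier G" using n Nc by blast
    have ng: "n \<otimes> g \<in> carrier G" using nc g by simp
    have "(n \<otimes> g) <# P #> inv (n \<otimes> g) \<subseteq> P"
    proof -
      have "n \<otimes> g \<otimes> x \<otimes> inv (n \<otimes> g) = n \<otimes> (g \<otimes> x \<otimes> inv g) \<otimes> inv n" if "x \<in> P" for x
        using that Pc nc g by (simp add: inv_mult_group m_assoc subset_iff)
      then show ?thesis using conj by (auto simp: conj_set_eq_image)
    qed
    \<comment> \<open>Conjugation gave only an inclusion in \<open>P\<close>; equal finite
      cardinalities make it an equality.\<close>
    moreover have "card ((n \<otimes> g) <# P #> inv (n \<otimes> g)) = card P"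
      unfolding conj_set_eq_image
      using Pc ng by (intro card_image inj_onI) (auto simp: subset_iff)
    ultimately have "n \<otimes> g \<in> normalizer G P"
      using finP ng Pc by (simp add: normalizer_iff card_subset_eq)
    moreover have "g = inv n \<otimes> (n \<otimes> g)" using nc g by (simp flip: m_assoc)
    moreover have "inv n \<in> N" using n subN by (rule subgroup.m_inv_closed[rotated])
    ultimately show ?thesis by (auto simp: set_mult_def)
  qed
  have nsub: "subgroup (normalizer G P) G" using normalizer_imp_subgroup[OF Pc] .
  \<comment> \<open>The factorization found has \<open>N\<close> on the left; normality of
    \<open>N\<close> lets the factors be exchanged.\<close>
  have "normalizer G P <#> N = N <#> normalizer G P"
    using commut_normal[OF nsub N] .
  then show ?thesis
    using factor set_mult_closed[OF subgroup.subset[OF nsub] Nc] by blast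
qed

section \<open>Finite groups all of whose Sylow subgroups are normal\<close>

text \<open>The generators in \<open>commutator_subgroup\<close>, with the same convention, so that
  commutator identities can be stated for elements.\<close>

definition commutator :: "('a, 'b) monoid_scheme \<Rightarrow> 'a \<Rightarrow> 'a \<Rightarrow> 'a" where
  "commutator G x y = x \<otimes>\<^bsub>G\<^esub> y \<otimes>\<^bsub>G\<^esub> inv\<^bsub>G\<^esub> x \<otimes>\<^bsub>G\<^esub> inv\<^bsub>G\<^esub> y"

context group
begin

section \<open>Commutator identities\<close>

lemma cancel_simps:
  assumes "x \<in> carrier G" "y \<in> carrier G"
  shows "x \<otimes> (inv x \<otimes> y) = y" "inv x \<otimes> (x \<otimes> y) = y"
  using assms by (simp_all flip: m_assoc)

lemma commutator_closed [simp]: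
  "x \<in> carrier G \<Longrightarrow> y \<in> carrier G \<Longrightarrow> commutator G x y \<in> carrier G"
  by (simp add: commutator_def)

lemma commutator_mult_left:
  assumes "x \<in> carrier G" "y \<in> carrier G" "z \<in> carrier G"
  shows "commutator G (x \<otimes> y) z = x \<otimes> commutator G y z \<otimes> inv x \<otimes> commutator G x z"
  using assms by (simp add: commutator_def m_assoc inv_mult_group cancel_simps)

lemma inv_commutator:
  assumes "x \<in> carrier G" "y \<in> carrier G"
  shows "inv (commutator G x y) = commutator G y x"
  using assms by (simp add: commutator_def m_assoc inv_mult_group)

lemma commutator_inv_left:
  assumes "x \<in> carrier G" "y \<in> carrier G"
  shows "commutator G (inv x) y = inv x \<otimes> commutator G y x \<otimes> x"
  using assms by (simp add: commutator_def m_assoc inv_mult_group cancel_simps)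

lemma commutator_conj_left:
  assumes "g \<in> carrier G" "x \<in> carrier G" "y \<in> carrier G"
  shows "commutator G (g \<otimes> x \<otimes> inv g) y = g \<otimes> commutator G x (inv g \<otimes> y \<otimes> g) \<otimes> inv g"
  using assms by (simp add: commutator_def m_assoc inv_mult_group cancel_simps)

lemma commutator_mem_normal:
  assumes "M \<lhd> G" "x \<in> M" "y \<in> carrier G"
  shows "commutator G x y \<in> M" "commutator G y x \<in> M"
proof -
  interpret M: normal M G by fact
  have "commutator G x y = x \<otimes> (y \<otimes> inv x \<otimes> inv y)"
    using assms by (simp add: commutator_def m_assoc)
  then show xy: "commutator G x y \<in> M"
    using assms by (simp add: M.inv_op_closed2)
  have "commutator G y x = inv (commutator G x y)"
    using assms by (simp add: inv_commutator)
  then show "commutator G y x \<in> M" using xy by simp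
qed

text \<open>A commutator in \<open>M\<close> means that its arguments commute modulo
  \<open>M\<close>, so this set is the preimage of the centralizer of the image of \<open>A\<close>
  in \<open>G Mod M\<close>. Working with commutators avoids cosets.\<close>

lemma subgroup_centralizer_mod:
  assumes M: "M \<lhd> G" and A: "A \<subseteq> carrier G"
  shows "subgroup {x \<in> carrier G. \<forall>a\<in>A. commutator G x a \<in> M} G"
proof -
  interpret M: normal M G by fact
  show ?thesis
  proof (rule subgroupI)
    fix x assume x: "x \<in> {x \<in> carrier G. \<forall>a\<in>A. commutator G x a \<in> M}"
    have "commutator G (inv x) a \<in> M" if "a \<in> A" for a
    proof -
      have "commutator G a x \<in> M"
        using x that A M.m_inv_closed[of "commutator G x a"] by (auto simp: inv_commutator subset_iff)
      then show ?thesis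
        using x that A M.inv_op_closed1 by (auto simp: commutator_inv_left subset_iff)
    qed
    then show "inv x \<in> {x \<in> carrier G. \<forall>a\<in>A. commutator G x a \<in> M}" using x by simp
  next
    fix x y
    assume xy: "x \<in> {x \<in> carrier G. \<forall>a\<in>A. commutator G x a \<in> M}"
      "y \<in> {x \<in> carrier G. \<forall>a\<in>A. commutator G x a \<in> M}"
    then have "commutator G (x \<otimes> y) a \<in> M" if "a \<in> A" for a
      using that A by (auto simp: commutator_mult_left subset_iff M.inv_op_closed2)
    then show "x \<otimes> y \<in> {x \<in> carrier G. \<forall>a\<in>A. commutator G x a \<in> M}" using xy by simp
  next
    have "\<one> \<in> {x \<in> carrier G. \<forall>a\<in>A. commutator G x a \<in> M}"
      using A by (auto simp: commutator_def)
    then show "{x \<in> carrier G. \<forall>a\<in>A. commutator G x a \<in> M} \<noteq> {}" by blast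
  qed auto
qed

text \<open>This is the preimage of the center of \<open>G Mod M\<close>, that is, one step of the
  upper central series above \<open>M\<close>.\<close>

lemma normal_center_mod:
  assumes M: "M \<lhd> G"
  shows "{x \<in> carrier G. \<forall>y\<in>carrier G. commutator G x y \<in> M} \<lhd> G"
proof (rule normal_invI)
  interpret M: normal M G by fact
  fix g x assume "g \<in> carrier G" "x \<in> {x \<in> carrier G. \<forall>y\<in>carrier G. commutator G x y \<in> M}"
  then show "g \<otimes> x \<otimes> inv g \<in> {x \<in> carrier G. \<forall>y\<in>carrier G. commutator G x y \<in> M}"
    by (auto simp: commutator_conj_left M.inv_op_closed2)
qed (rule subgroup_centralizer_mod[OF M order_refl])

text \<open>\<open>G Mod K\<close> is a nontrivial group of prime power order, so it has a
  nontrivial central coset; any representative \<open>z\<close> of that coset will do.\<close>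

lemma p_group_central_mod:
  assumes p: "prime p" and ord: "order G = p ^ n" and K: "K \<lhd> G" and ne: "K \<noteq> carrier G"
  shows "\<exists>z\<in>carrier G - K. \<forall>g\<in>carrier G. commutator G g z \<in> K"
proof -
  interpret K: normal K G by fact
  interpret Q: group "G Mod K" by (rule K.factorgroup_is_group)
  have fin: "finite (carrier G)"
    using ord p order_gt_0_iff_finite by (metis prime_gt_0_nat zero_less_power)
  have "order (G Mod K) dvd p ^ n"
    using lagrange[OF K.subgroup_axioms] ord by (simp add: order_def FactGroup_def) (metis dvd_triv_left)
  then obtain k where ordQ: "order (G Mod K) = p ^ k"
    using p divides_primepow_nat by auto
  have "carrier (G Mod K) \<noteq> {\<one>\<^bsub>G Mod K\<^esub>}"
    using K.fact_group_trivial_iff[OF fin] ne by blast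
  from Q.p_group_nontrivial_center[OF p ordQ this]
  obtain Z where Z: "Z \<in> carrier (G Mod K)" "Z \<noteq> K"
    and central: "\<And>R. R \<in> carrier (G Mod K) \<Longrightarrow> R <#> Z = Z <#> R" by auto
  obtain z where z: "z \<in> carrier G" "Z = K #> z"
    using Z by (auto simp: carrier_FactGroup)
  have "z \<notin> K" using Z z K.subgroup_axioms coset_join2 by blast
  moreover have "commutator G g z \<in> K" if g: "g \<in> carrier G" for g
  proof -
    have "K #> (g \<otimes> z) = K #> (z \<otimes> g)"
      using central[of "K #> g"] g z by (simp add: K.rcos_sum carrier_FactGroup)
    then have "g \<otimes> z \<otimes> inv (z \<otimes> g) \<in> K"
      using g z K.rcos_module_imp[OF is_group, of "z \<otimes> g" "g \<otimes> z"] K.subgroup_axioms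
      by (metis m_closed rcos_self)
    then show ?thesis using g z by (simp add: commutator_def inv_mult_group m_assoc)
  qed
  ultimately show ?thesis using z by blast
qed


text \<open>Take a prime \<open>p\<close> dividing the index of \<open>M\<close> and \<open>z\<close> in the Sylow \<open>p\<close>-subgroup \<open>P\<close> central
  modulo \<open>M\<close> in \<open>P\<close>. Then \<open>z\<close> commutes modulo \<open>M\<close> with every Sylow subgroup, hence with \<open>G\<close>.\<close>

lemma central_mod_if_sylow_normal:
  assumes fin: "finite (carrier G)"
    and sylow: "\<And>p P. prime p \<Longrightarrow> subgroup P G \<Longrightarrow> card P = p ^ multiplicity p (order G) \<Longrightarrow> P \<lhd> G"
    and M: "M \<lhd> G" and ne: "M \<noteq> carrier G"
  shows "\<exists>z\<in>carrier G - M. \<forall>x\<in>carrier G. commutator G z x \<in> M"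
proof -
  interpret M: normal M G by fact
  have ord0: "order G \<noteq> 0" using fin order_gt_0_iff_finite by simp
  have sylow_ex: "\<exists>P. P \<lhd> G \<and> card P = p ^ multiplicity p (order G)" if p: "prime p" for p
  proof -
    obtain m where "order G = p ^ multiplicity p (order G) * m"
      using multiplicity_dvd[of p "order G"] by (auto elim: dvdE)
    then show ?thesis using sylow_thm[OF p is_group _ fin] sylow[OF p] by blast
  qed
  have lag: "card (rcosets M) * card M = order G" using lagrange[OF M.subgroup_axioms] .
  have "card (rcosets M) \<noteq> 1"
  proof
    assume "card (rcosets M) = 1"
    then have "card M = card (carrier G)" using lag by (simp add: order_def)
    then show False using card_subset_eq[OF fin M.subset] ne by blast
  qed
  then obtain p where p: "prime p" and pdvd: "p dvd card (rcosets M)"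
    using prime_factor_nat by blast
  obtain P where P: "P \<lhd> G" and cardP: "card P = p ^ multiplicity p (order G)"
    using sylow_ex[OF p] by blast
  interpret P: normal P G by fact
  interpret PG: group "G\<lparr>carrier := P\<rparr>" using P.subgroup_axioms by (rule subgroup_imp_group)
  have card_dvd: "card A dvd card B" if "subgroup A G" "subgroup B G" "A \<subseteq> B" for A B
    using group.lagrange[OF subgroup_imp_group[OF that(2)] subgroup_incl[OF that]]
    by (metis dvd_triv_right order_def partial_object.select_convs(1) partial_object.surjective
        partial_object.update_convs(1))
  \<comment> \<open>Otherwise \<open>card M\<close> would contain the full power of \<open>p\<close>
    in \<open>order G\<close>, and the index of \<open>M\<close> would contribute one more factor
    \<open>p\<close>.\<close>
  have "\<not> P \<subseteq> M"
  proof
    assume "P \<subseteq> M"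
    then have "p ^ multiplicity p (order G) dvd card M"
      using card_dvd[OF P.subgroup_axioms M.subgroup_axioms] cardP by simp
    then have "p ^ Suc (multiplicity p (order G)) dvd order G"
      using pdvd lag by (metis mult_dvd_mono power_Suc)
    then show False
      using not_power_Suc_multiplicity_dvd[OF p ord0] by blast
  qed
  then have "M \<inter> P \<noteq> P" by blast
  then have "M \<inter> P \<noteq> carrier (G\<lparr>carrier := P\<rparr>)" by simp
  moreover have "order (G\<lparr>carrier := P\<rparr>) = p ^ multiplicity p (order G)"
    using cardP by (simp add: order_def)
  moreover have "M \<inter> P \<lhd> G\<lparr>carrier := P\<rparr>"
    using normal_Int_subgroup[OF P.subgroup_axioms M] .
  ultimately have "\<exists>z\<in>carrier (G\<lparr>carrier := P\<rparr>) - (M \<inter> P).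
      \<forall>g\<in>carrier (G\<lparr>carrier := P\<rparr>). commutator (G\<lparr>carrier := P\<rparr>) g z \<in> M \<inter> P"
    by (intro PG.p_group_central_mod[OF p])
  then obtain z where z: "z \<in> P" "z \<notin> M"
    and zP: "\<And>g. g \<in> P \<Longrightarrow> commutator (G\<lparr>carrier := P\<rparr>) g z \<in> M \<inter> P"
    by auto
  have zc: "z \<in> carrier G" using z P.mem_carrier by blast
  \<comment> \<open>The centralizer of \<open>z\<close> modulo \<open>M\<close>. It contains a Sylow
    subgroup for every prime, so \<open>order G\<close> divides \<open>card C\<close> and
    \<open>C\<close> is everything.\<close>
  define C where "C = {x \<in> carrier G. \<forall>a\<in>{z}. commutator G x a \<in> M}"
  have C: "subgroup C G"
    unfolding C_def using M zc by (intro subgroup_centralizer_mod) auto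
  have "p' ^ multiplicity p' (order G) dvd card C" if p': "prime p'" for p'
  proof -
    obtain R where R: "R \<lhd> G" and cardR: "card R = p' ^ multiplicity p' (order G)"
      and RC: "R \<subseteq> C"
    proof (cases "p' = p")
      case True
      have "commutator G g z \<in> M" if "g \<in> P" for g
        using zP[OF that] that z P.subgroup_axioms by (simp add: commutator_def m_inv_consistent)
      then have "P \<subseteq> C" by (auto simp: C_def)
      then show ?thesis using that[OF P] cardP True by simp
    next
      case False
      obtain R where R: "R \<lhd> G" and cardR: "card R = p' ^ multiplicity p' (order G)"
        using sylow_ex[OF p'] by blast
      have PR: "subgroup (P \<inter> R) G"
        using subgroups_Inter_pair P.subgroup_axioms R normal_imp_subgroup by blast
      have "card (P \<inter> R) dvd card P" "card (P \<inter> R) dvd card R"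
        using card_dvd[OF PR] P.subgroup_axioms R normal_imp_subgroup by blast+
      \<comment> \<open>Normal subgroups of coprime orders centralize each other: commutators
        between them lie in their intersection, which is trivial.\<close>
      moreover have "coprime (card P) (card R)"
        using cardP cardR p p' False by (simp add: primes_coprime)
      ultimately have "card (P \<inter> R) = 1"
        by (metis coprime_common_divisor_nat)
      then have "P \<inter> R = {\<one>}"
        using subgroup.one_closed[OF PR] by (metis card_1_singletonE singletonD)
      moreover have "commutator G x z \<in> P \<inter> R" if "x \<in> R" for x
        using that z commutator_mem_normal(2)[OF P] commutator_mem_normal(1)[OF R] zc
          subgroup.mem_carrier[OF normal_imp_subgroup[OF R]] by simp
      ultimately have "R \<subseteq> C"
        using subgroup.subset[OF normal_imp_subgroup[OF R]] by (auto simp: C_def)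
      then show ?thesis using that R cardR by blast
    qed
    then show ?thesis using card_dvd[OF normal_imp_subgroup[OF R] C RC] by simp
  qed
  moreover have "card C \<noteq> 0"
    using subgroup.finite_imp_card_positive[OF C fin] by simp
  ultimately have "multiplicity p' (order G) \<le> multiplicity p' (card C)" if "prime p'" for p'
    using that by (meson multiplicity_geI not_prime_unit)
  then have "order G dvd card C"
    using ord0 by (intro multiplicity_le_imp_dvd) auto
  then have "card (carrier G) \<le> card C"
    using \<open>card C \<noteq> 0\<close> by (simp add: order_def dvd_imp_le)
  then have "C = carrier G"
    using card_seteq[OF fin subgroup.subset[OF C]] by simp
  \<comment> \<open>Membership in \<open>C\<close> concerns \<open>commutator G x z\<close>;
    inversion exchanges the two arguments.\<close>
  then have "commutator G z x \<in> M" if "x \<in> carrier G" for x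
    using that zc M.m_inv_closed[of "commutator G x z"] by (auto simp: C_def inv_commutator)
  then show ?thesis using z zc by blast
qed

section \<open>The lower central series and nilpotency\<close>

lemma commutator_subgroup_subset:
  assumes "subgroup M G" and "\<And>h k. h \<in> H \<Longrightarrow> k \<in> K \<Longrightarrow> commutator G h k \<in> M"
  shows "commutator_subgroup G H K \<subseteq> M"
  unfolding commutator_subgroup_def
  using assms by (intro generate_subgroup_incl) (auto simp: commutator_def)

lemma one_mem_lower_central: "\<one> \<in> lower_central G n"
  by (cases n) (auto simp: commutator_subgroup_def intro: generate.one)

text \<open>The induction shows that every normal subgroup \<open>M\<close> contains a term of the
  lower central series; the trivial \<open>M\<close> gives nilpotency. The preimage
  \<open>M'\<close> of the center of \<open>G Mod M\<close> is strictly larger than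
  \<open>M\<close>, and if a term lies in \<open>M'\<close>, the next one lies in
  \<open>M\<close>.\<close>

theorem nilpotent_if_sylow_normal:
  assumes fin: "finite (carrier G)"
    and sylow: "\<And>p P. prime p \<Longrightarrow> subgroup P G \<Longrightarrow> card P = p ^ multiplicity p (order G) \<Longrightarrow> P \<lhd> G"
  shows "nilpotent_group G"
proof -
  have "\<exists>n. lower_central G n \<subseteq> M" if "M \<lhd> G" for M
    using that
  proof (induction "card (carrier G - M)" arbitrary: M rule: less_induct)
    case less
    then interpret M: normal M G by simp
    show ?case
    proof (cases "M = carrier G")
      case True
      then show ?thesis by (intro exI[of _ 0]) simp
    next
      case False
      define M' where "M' = {x \<in> carrier G. \<forall>y\<in>carrier G. commutator G x y \<in> M}"
      have "\<exists>z\<in>carrier G - M. \<forall>x\<in>carrier G. commutator G z x \<in> M"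
        using fin sylow less.prems False by (rule central_mod_if_sylow_normal)
      then obtain z where "z \<in> carrier G - M" "z \<in> M'"
        by (auto simp: M'_def)
      moreover have "M \<subseteq> M'"
        using commutator_mem_normal[OF less.prems] by (auto simp: M'_def)
      ultimately have "carrier G - M' \<subset> carrier G - M" by blast
      then have "card (carrier G - M') < card (carrier G - M)"
        using fin by (intro psubset_card_mono) auto
      moreover have "M' \<lhd> G" unfolding M'_def by (rule normal_center_mod[OF less.prems])
      ultimately obtain n where "lower_central G n \<subseteq> M'" using less.hyps by blast
      then have "lower_central G (Suc n) \<subseteq> M"
        unfolding lower_central.simps
        by (intro commutator_subgroup_subset[OF M.subgroup_axioms]) (auto simp: M'_def)
      then show ?thesis by blast
    qed
  qed
  from this[OF one_is_normal] obtain n where "lower_central G n \<subseteq> {\<one>}" ..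
  then have "lower_central G n = {\<one>}" using one_mem_lower_central[of n] by blast
  then show ?thesis using is_group by (auto simp: nilpotent_group_def)
qed

end

section \<open>Minimal supplements\<close>

text \<open>The case of a single extension. Minimality is measured by
  \<open>card (N \<inter> T)\<close>, so neither \<open>G\<close> nor \<open>H\<close> has to be
  finite.\<close>

lemma (in group) nilpotent_supplement_exists:
  assumes N: "N \<lhd> G" and fin: "finite N" and H: "subgroup H G" and sup: "carrier G = H <#> N"
  shows "\<exists>T. subgroup T G \<and> T \<subseteq> H \<and> carrier G = T <#> N \<and> nilpotent_group (G\<lparr>carrier := N \<inter> T\<rparr>)"
proof -
  define suppl where "suppl T \<longleftrightarrow> subgroup T G \<and> T \<subseteq> H \<and> carrier G = T <#> N" for T
  have "suppl H" using H sup by (simp add: suppl_def)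
  then obtain T where T: "suppl T" and min: "\<And>T'. suppl T' \<Longrightarrow> card (N \<inter> T) \<le> card (N \<inter> T')"
    using ex_has_least_nat[of suppl H "\<lambda>T. card (N \<inter> T)"] by blast
  have subT: "subgroup T G" using T by (simp add: suppl_def)
  have subN: "subgroup N G" using N by (rule normal_imp_subgroup)
  let ?K = "N \<inter> T" and ?L = "G\<lparr>carrier := T\<rparr>"
  interpret L: group ?L using subT by (rule subgroup_imp_group)
  have KL: "?K \<lhd> ?L" using normal_Int_subgroup[OF subT N] .
  have subK: "subgroup ?K G" using subgroups_Inter_pair[OF subN subT] .
  have finK: "finite ?K" using fin by simp
  interpret K: group "G\<lparr>carrier := ?K\<rparr>" using subK by (rule subgroup_imp_group)
  have "nilpotent_group (G\<lparr>carrier := ?K\<rparr>)"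
  proof (rule K.nilpotent_if_sylow_normal)
    fix p :: nat and P
    assume p: "prime p" and P: "subgroup P (G\<lparr>carrier := ?K\<rparr>)"
      and cardP: "card P = p ^ multiplicity p (order (G\<lparr>carrier := ?K\<rparr>))"
    have PK: "P \<subseteq> ?K" using subgroup.subset[OF P] by simp
    then have PL: "P \<subseteq> carrier ?L" by simp
    let ?T' = "normalizer ?L P"
    \<comment> \<open>The Frattini argument is applied inside \<open>T\<close> to its finite normal
      subgroup \<open>?K\<close>.\<close>
    have T_eq: "T = ?T' <#> ?K"
      using L.frattini_argument[OF KL finK p _, of P] P cardP by (simp add: order_def)
    have subT'L: "subgroup ?T' ?L" using L.normalizer_imp_subgroup[OF PL] .
    then have subT': "subgroup ?T' G" by (rule incl_subgroup[OF subT])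
    have T'T: "?T' \<subseteq> T" using subgroup.subset[OF subT'L] by simp
    \<comment> \<open>The factor \<open>?K\<close> is absorbed by \<open>N\<close>, so the
      normalizer alone still supplements \<open>N\<close>.\<close>
    have "?K <#> N \<subseteq> N"
      using subgroup_mult_id[OF subN] mono_set_mult[of ?K N N N] by auto
    then have "?T' <#> (?K <#> N) \<subseteq> ?T' <#> N"
      by (intro mono_set_mult) auto
    moreover have "carrier G = ?T' <#> (?K <#> N)"
      using T T_eq set_mult_assoc[OF subgroup.subset[OF subT'] subgroup.subset[OF subK] subgroup.subset[OF subN]]
      by (simp add: suppl_def)
    ultimately have "carrier G = ?T' <#> N"
      using set_mult_closed[OF subgroup.subset[OF subT'] subgroup.subset[OF subN]] by blast
    then have "suppl ?T'" using subT' T'T T by (auto simp: suppl_def)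
    \<comment> \<open>The left side is contained in \<open>?K\<close> and, by minimality of
      \<open>T\<close>, is at least as large; hence \<open>?K\<close> normalizes
      \<open>P\<close>.\<close>
    then have "N \<inter> ?T' = ?K"
      using min T'T finK by (intro card_seteq) auto
    then have norm: "g <#\<^bsub>?L\<^esub> P #>\<^bsub>?L\<^esub> inv\<^bsub>?L\<^esub> g = P" if "g \<in> ?K" for g
      using that L.normalizer_iff[OF PL] by blast
    show "P \<lhd> G\<lparr>carrier := ?K\<rparr>"
    proof (rule K.normal_invI[OF P])
      fix g x assume g: "g \<in> carrier (G\<lparr>carrier := ?K\<rparr>)" and x: "x \<in> P"
      have "g \<otimes> x \<otimes> inv\<^bsub>?L\<^esub> g \<in> P"
        using norm[of g] g x L.conj_set_eq_image[of g P "inv\<^bsub>?L\<^esub> g"] by auto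
      then show "g \<otimes>\<^bsub>G\<lparr>carrier := ?K\<rparr>\<^esub> x \<otimes>\<^bsub>G\<lparr>carrier := ?K\<rparr>\<^esub> inv\<^bsub>G\<lparr>carrier := ?K\<rparr>\<^esub> g \<in> P"
        using g m_inv_consistent[OF subK, of g] m_inv_consistent[OF subT, of g] by simp
    qed
  qed (use finK in simp)
  then show ?thesis using T by (auto simp: suppl_def)
qed

section \<open>Transport along isomorphisms\<close>

lemma (in group_hom) commutator_subgroup_img:
  assumes "A \<subseteq> carrier G" "B \<subseteq> carrier G"
  shows "h ` commutator_subgroup G A B = commutator_subgroup H (h ` A) (h ` B)"
proof -
  have hom: "h (a \<otimes>\<^bsub>G\<^esub> b \<otimes>\<^bsub>G\<^esub> inv\<^bsub>G\<^esub> a \<otimes>\<^bsub>G\<^esub> inv\<^bsub>G\<^esub> b) = h a \<otimes>\<^bsub>H\<^esub> h b \<otimes>\<^bsub>H\<^esub> inv\<^bsub>H\<^esub> h a \<otimes>\<^bsub>H\<^esub> inv\<^bsub>H\<^esub> h b"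
    if "a \<in> A" "b \<in> B" for a b
    using that assms by (simp add: subset_iff)
  have img: "h ` (\<Union>a\<in>A. \<Union>b\<in>B. {a \<otimes>\<^bsub>G\<^esub> b \<otimes>\<^bsub>G\<^esub> inv\<^bsub>G\<^esub> a \<otimes>\<^bsub>G\<^esub> inv\<^bsub>G\<^esub> b}) =
    (\<Union>a\<in>h ` A. \<Union>b\<in>h ` B. {a \<otimes>\<^bsub>H\<^esub> b \<otimes>\<^bsub>H\<^esub> inv\<^bsub>H\<^esub> a \<otimes>\<^bsub>H\<^esub> inv\<^bsub>H\<^esub> b})"
    by (simp add: image_UN hom)
  have "(\<Union>a\<in>A. \<Union>b\<in>B. {a \<otimes>\<^bsub>G\<^esub> b \<otimes>\<^bsub>G\<^esub> inv\<^bsub>G\<^esub> a \<otimes>\<^bsub>G\<^esub> inv\<^bsub>G\<^esub> b}) \<subseteq> carrier G"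
    using assms by (auto simp: subset_iff)
  from generate_img[OF this] show ?thesis
    unfolding commutator_subgroup_def img by (rule sym)
qed

lemma (in group) commutator_subgroup_closed:
  assumes "A \<subseteq> carrier G" "B \<subseteq> carrier G"
  shows "commutator_subgroup G A B \<subseteq> carrier G"
  using assms by (intro commutator_subgroup_subset[OF subgroup_self]) (auto intro: commutator_closed)

lemma (in group) lower_central_closed: "lower_central G n \<subseteq> carrier G"
  by (induction n) (simp_all add: commutator_subgroup_closed)

text \<open>A surjective homomorphism maps each term of the lower central series onto the
  corresponding term.\<close>

lemma nilpotent_group_iso:
  assumes A: "nilpotent_group A" and h: "h \<in> iso A B" and B: "group B"
  shows "nilpotent_group B"
proof -
  have "group A" using A by (simp add: nilpotent_group_def)
  then interpret h: group_hom A B h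
    using h B by (simp add: group_hom_def group_hom_axioms_def iso_iff)
  have img: "h ` carrier A = carrier B" using h by (simp add: iso_iff)
  have "lower_central B n = h ` lower_central A n" for n
    by (induction n) (simp_all add: img h.commutator_subgroup_img h.G.lower_central_closed)
  moreover obtain n where "lower_central A n = {\<one>\<^bsub>A\<^esub>}" using A by (auto simp: nilpotent_group_def)
  ultimately have "lower_central B n = {\<one>\<^bsub>B\<^esub>}" by simp
  then show ?thesis using B by (auto simp: nilpotent_group_def)
qed

section \<open>Isomorphisms that map \<open>G\<close> onto itself, and images of supplements under
  them\<close>

lemma relative_iso_refl: "(\<lambda>x. x) \<in> relative_iso G E E"
  by (simp add: relative_iso_def iso_set_refl)

lemma relative_iso_comp:
  "i \<in> relative_iso G E\<^sub>1 E\<^sub>2 \<Longrightarrow> j \<in> relative_iso G E\<^sub>2 E\<^sub>3 \<Longrightarrow> j \<circ> i \<in> relative_iso G E\<^sub>1 E\<^sub>3"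
  by (auto simp: relative_iso_def intro: iso_set_trans) (metis image_eqI image_image)+

lemma relative_iso_inv:
  assumes "group E\<^sub>1" "carrier G \<subseteq> carrier E\<^sub>1" "j \<in> relative_iso G E\<^sub>1 E\<^sub>2"
  shows "inv_into (carrier E\<^sub>1) j \<in> relative_iso G E\<^sub>2 E\<^sub>1"
proof -
  have "inv_into (carrier E\<^sub>1) j ` j ` carrier G = carrier G"
    using assms by (intro inv_into_image_cancel) (auto simp: relative_iso_def iso_iff)
  then show ?thesis
    using assms group.iso_set_sym by (auto simp: relative_iso_def)
qed

lemma supplement_image:
  assumes grp: "group E\<^sub>1" "group E\<^sub>2" and sub: "carrier G \<subseteq> carrier E\<^sub>1"
    and j: "j \<in> relative_iso G E\<^sub>1 E\<^sub>2" and T: "supplement G E\<^sub>1 T"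
  shows "supplement G E\<^sub>2 (j ` T)"
proof -
  have iso: "j \<in> iso E\<^sub>1 E\<^sub>2" and img: "j ` carrier G = carrier G"
    using j by (auto simp: relative_iso_def)
  have T': "subgroup T E\<^sub>1" using T by (simp add: supplement_def)
  have "carrier E\<^sub>2 = j ` (T <#>\<^bsub>E\<^sub>1\<^esub> carrier G)"
    using iso T by (simp add: iso_iff supplement_def)
  also have "\<dots> = j ` T <#>\<^bsub>E\<^sub>2\<^esub> carrier G"
    using iso set_mult_hom[of j E\<^sub>1 E\<^sub>2 T "carrier G"] subgroup.subset[OF T'] sub img
    by (simp add: iso_iff)
  finally show ?thesis
    using subgroup.iso_subgroup[OF T' grp iso] by (simp add: supplement_def)
qed

lemma nilpotent_inter_image:
  assumes grp: "group E\<^sub>1" "group E\<^sub>2" and G: "subgroup (carrier G) E\<^sub>1"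
    and j: "j \<in> relative_iso G E\<^sub>1 E\<^sub>2" and T: "subgroup T E\<^sub>1"
    and nil: "nilpotent_group (E\<^sub>1\<lparr>carrier := carrier G \<inter> T\<rparr>)"
  shows "nilpotent_group (E\<^sub>2\<lparr>carrier := carrier G \<inter> j ` T\<rparr>)"
proof -
  have iso: "j \<in> iso E\<^sub>1 E\<^sub>2" and img: "j ` carrier G = carrier G"
    using j by (auto simp: relative_iso_def)
  have GT: "subgroup (carrier G \<inter> T) E\<^sub>1"
    using group.subgroups_Inter_pair[OF grp(1) G T] .
  have "j ` (carrier G \<inter> T) = j ` carrier G \<inter> j ` T"
    using iso subgroup.subset[OF G] subgroup.subset[OF T]
    by (intro inj_on_image_Int) (auto simp: iso_iff)
  then have eq: "j ` (carrier G \<inter> T) = carrier G \<inter> j ` T" using img by simp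
  have "group (E\<^sub>2\<lparr>carrier := j ` (carrier G \<inter> T)\<rparr>)"
    using group.subgroup_imp_group[OF grp(2) subgroup.iso_subgroup[OF GT grp iso]] .
  then show ?thesis
    using nilpotent_group_iso[OF nil iso_restrict[OF iso grp GT]] eq by simp
qed

theorem proposition4p1p2:
  fixes G :: "('a, 'c) monoid_scheme"
    and F :: "('a, 'b) monoid_scheme set"
  assumes "group G" and "finite (carrier G)"
    and "\<forall>E\<in>F. group_extension G E"
  shows "\<forall>S\<in>preserved_supplement_functions G F.
           \<exists>S'\<in>preserved_supplement_functions G F.
             \<forall>E\<in>F. nilpotent_group (E\<lparr>carrier := carrier G \<inter> S' E\<rparr>) \<and> S' E \<subseteq> S E"
proof
  fix S assume S: "S \<in> preserved_supplement_functions G F"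
  have normal: "carrier G \<lhd> E" if "E \<in> F" for E
    using that assms by (simp add: group_extension_def)
  then have subG: "subgroup (carrier G) E" if "E \<in> F" for E
    using that normal_imp_subgroup by blast
  then have GE: "carrier G \<subseteq> carrier E" if "E \<in> F" for E
    using that subgroup.subset by blast
  have grp: "group E" if "E \<in> F" for E
    using normal[OF that] by (simp add: normal_def)
  have suppl: "supplement G E (S E)" if "E \<in> F" for E
    using S that by (auto simp: preserved_supplement_functions_def supplement_functions_def)
  have pres: "\<exists>j\<in>relative_iso G E\<^sub>1 E\<^sub>2. j ` S E\<^sub>1 = S E\<^sub>2"
    if "E\<^sub>1 \<in> F" "E\<^sub>2 \<in> F" "relative_iso G E\<^sub>1 E\<^sub>2 \<noteq> {}" for E\<^sub>1 E\<^sub>2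
    using S that by (simp add: preserved_supplement_functions_def preserved_by_iso_def)
  define rep where "rep E = (SOME E\<^sub>0. E\<^sub>0 \<in> F \<and> relative_iso G E\<^sub>0 E \<noteq> {})" for E
  have rep: "rep E \<in> F" "relative_iso G (rep E) E \<noteq> {}" if "E \<in> F" for E
  proof -
    have "\<exists>E\<^sub>0. E\<^sub>0 \<in> F \<and> relative_iso G E\<^sub>0 E \<noteq> {}"
      using that relative_iso_refl[of G E] by blast
    then have "rep E \<in> F \<and> relative_iso G (rep E) E \<noteq> {}"
      unfolding rep_def by (rule someI_ex)
    then show "rep E \<in> F" "relative_iso G (rep E) E \<noteq> {}" by auto
  qed
  have rep_eq: "rep E\<^sub>1 = rep E\<^sub>2"
    if "E\<^sub>1 \<in> F" "E\<^sub>2 \<in> F" and j: "j \<in> relative_iso G E\<^sub>1 E\<^sub>2" for E\<^sub>1 E\<^sub>2 j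
  proof -
    \<comment> \<open>Isomorphic members satisfy the same predicate under \<open>SOME\<close>, so
      their representatives are equal and not merely isomorphic.\<close>
    have "relative_iso G E\<^sub>0 E\<^sub>1 \<noteq> {} \<longleftrightarrow> relative_iso G E\<^sub>0 E\<^sub>2 \<noteq> {}" for E\<^sub>0
      using relative_iso_comp j relative_iso_inv[OF grp GE j] that by blast
    then show ?thesis by (simp add: rep_def)
  qed
  \<comment> \<open>Chosen independently for each member, \<open>T\<close> need not be preserved;
    only its values at representatives enter \<open>S'\<close>.\<close>
  have "\<exists>T. \<forall>E\<in>F. supplement G E (T E) \<and> T E \<subseteq> S E \<and>
      nilpotent_group (E\<lparr>carrier := carrier G \<inter> T E\<rparr>)"
    using group.nilpotent_supplement_exists[OF grp normal assms(2)] suppl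
    by (intro bchoice) (simp add: supplement_def, blast)
  then obtain T where T: "\<And>E. E \<in> F \<Longrightarrow> supplement G E (T E)" "\<And>E. E \<in> F \<Longrightarrow> T E \<subseteq> S E"
      "\<And>E. E \<in> F \<Longrightarrow> nilpotent_group (E\<lparr>carrier := carrier G \<inter> T E\<rparr>)"
    by blast
  \<comment> \<open>Here the preservation of \<open>S\<close> is used: as \<open>j E\<close> maps
    \<open>S (rep E)\<close> onto \<open>S E\<close>, the image of \<open>T (rep E)\<close> stays
    inside \<open>S E\<close>.\<close>
  have "\<exists>j. \<forall>E\<in>F. j E \<in> relative_iso G (rep E) E \<and> j E ` S (rep E) = S E"
  proof (intro bchoice ballI)
    fix E assume "E \<in> F"
    with pres[OF rep(1) this rep(2)]
    show "\<exists>j. j \<in> relative_iso G (rep E) E \<and> j ` S (rep E) = S E" by blast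
  qed
  then obtain j where j: "\<And>E. E \<in> F \<Longrightarrow> j E \<in> relative_iso G (rep E) E"
      "\<And>E. E \<in> F \<Longrightarrow> j E ` S (rep E) = S E"
    by blast
  define S' where "S' = (\<lambda>E\<in>F. j E ` T (rep E))"
  have S'_iso: "\<exists>k\<in>relative_iso G E\<^sub>1 E\<^sub>2. k ` S' E\<^sub>1 = S' E\<^sub>2"
    if E: "E\<^sub>1 \<in> F" "E\<^sub>2 \<in> F" and ne: "relative_iso G E\<^sub>1 E\<^sub>2 \<noteq> {}" for E\<^sub>1 E\<^sub>2
  proof -
    let ?R = "rep E\<^sub>1"
    obtain i where "i \<in> relative_iso G E\<^sub>1 E\<^sub>2" using ne by blast
    then have eq: "rep E\<^sub>2 = ?R" using rep_eq[OF E] by simp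
    have RF: "?R \<in> F" using rep(1)[OF E(1)] .
    let ?i = "inv_into (carrier ?R) (j E\<^sub>1)"
    \<comment> \<open>The witness passes through the common representative. The given isomorphism
      \<open>i\<close> served only to show that the representatives agree and need not map
      \<open>S' E\<^sub>1\<close> to \<open>S' E\<^sub>2\<close>.\<close>
    have "j E\<^sub>2 \<circ> ?i \<in> relative_iso G E\<^sub>1 E\<^sub>2"
      using relative_iso_comp[OF relative_iso_inv[OF grp[OF RF] GE[OF RF] j(1)[OF E(1)]]]
        j(1)[OF E(2)] eq by simp
    moreover have "?i ` j E\<^sub>1 ` T ?R = T ?R"
      using j(1)[OF E(1)] T(1)[OF RF]
      by (intro inv_into_image_cancel)
        (auto simp: relative_iso_def iso_iff supplement_def dest: subgroup.subset)
    then have "(j E\<^sub>2 \<circ> ?i) ` S' E\<^sub>1 = S' E\<^sub>2"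
      using E eq unfolding image_comp[symmetric] by (simp add: S'_def)
    ultimately show ?thesis by blast
  qed
  have "supplement G E (S' E)" if E: "E \<in> F" for E
    using supplement_image[OF grp grp GE j(1) T(1)] rep E by (simp add: S'_def)
  then have "S' \<in> preserved_supplement_functions G F"
    using S'_iso
    by (auto simp: preserved_supplement_functions_def supplement_functions_def preserved_by_iso_def
        S'_def)
  moreover have "nilpotent_group (E\<lparr>carrier := carrier G \<inter> S' E\<rparr>)" if E: "E \<in> F" for E
    using nilpotent_inter_image[OF grp grp subG j(1) _ T(3)] T(1) rep E
    by (simp add: S'_def supplement_def)
  moreover have "S' E \<subseteq> S E" if E: "E \<in> F" for E
    using j(2)[OF E] T(2) rep(1)[OF E] E by (auto simp: S'_def)
  ultimately show "\<exists>S'\<in>preserved_supplement_functions G F.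
      \<forall>E\<in>F. nilpotent_group (E\<lparr>carrier := carrier G \<inter> S' E\<rparr>) \<and> S' E \<subseteq> S E"
    by blast
qed

end
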